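(* For every connected graph $G$ on $n$ vertices, $$ b(G) \leq \left\lceil \sqrt{\tfrac{4n}{3}} \right\rceil + 1. $$
   Context: Burning process on a graph $G$: at step $1$ one vertex is set on fire; at every step $i \geq 2$, all neighbours of vertices on fire catch fire, and additionally one new vertex is set on fire. The burning number $b(G)$ is the least $k$ such that some choice of vertices makes the whole graph on fire at the end of step $k$; equivalently, the least $k$ such that there are vertices $v_1,\dots,v_k$ with $\bigcup_{i=1}^{k} N_{k-i}[v_i] = V(G)$, where $N_r[v]$ is the set of vertices at distance at most $r$ from $v$. *)

theory Defs
  imports Complex_Main "Graph_Theory.Graph_Theory"
begin

text \<open>
  Finite simple graphs are modelled by the locale \<open>graph\<close> (finite symmetric digraphs without loops
  and without multiple arcs): every undirected edge is a pair of opposite arcs.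
  \<open>connected G\<close> includes that \<open>G\<close> has at least one vertex.
\<close>

definition neighbours :: "('a, 'b) pre_digraph \<Rightarrow> 'a set \<Rightarrow> 'a set" where
  "neighbours G S = {w. \<exists>u\<in>S. u \<rightarrow>\<^bsub>G\<^esub> w}"

text \<open>
  \<open>on_fire G v i\<close> is the set of vertices on fire at the end of step \<open>i\<close>, where \<open>v j\<close> is the vertex
  set on fire at step \<open>j \<ge> 1\<close>. Nothing is on fire before step 1. The vertex \<open>v j\<close> may already be
  on fire, in which case setting it on fire has no effect; this is the convention under which the
  process agrees with the covering description in \<open>burning_number_eq_covering\<close> below.
\<close>

fun on_fire :: "('a, 'b) pre_digraph \<Rightarrow> (nat \<Rightarrow> 'a) \<Rightarrow> nat \<Rightarrow> 'a set" where
  "on_fire G v 0 = {}"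
| "on_fire G v (Suc i) = on_fire G v i \<union> neighbours G (on_fire G v i) \<union> {v (Suc i)}"

definition burning_number :: "('a, 'b) pre_digraph \<Rightarrow> nat" where
  "burning_number G =
     (LEAST k. \<exists>v. (\<forall>i\<in>{1..k}. v i \<in> verts G) \<and> on_fire G v k = verts G)"

text \<open>Distance is the library's \<open>\<mu>\<close> with all arc weights equal to 1.\<close>

definition closed_nbhd :: "('a, 'b) pre_digraph \<Rightarrow> nat \<Rightarrow> 'a \<Rightarrow> 'a set" where
  "closed_nbhd G r v = {u \<in> verts G. wf_digraph.\<mu> G (\<lambda>_. 1) v u \<le> ereal (real r)}"

context wf_digraph
begin

lemma mu_le_iff_awalk:
  "\<mu> (\<lambda>_. 1) v u \<le> ereal (real r) \<longleftrightarrow> (\<exists>p. awalk v p u \<and> length p \<le> r)"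
proof
  have cost: "awalk_cost (\<lambda>_. 1) p = real (length p)" for p :: "'b list"
    by (induction p) auto
  {
    assume "\<mu> (\<lambda>_. 1) v u \<le> ereal (real r)"
    also have "\<dots> < ereal (real r + 1)" by simp
    finally obtain p where "awalk v p u" "ereal (awalk_cost (\<lambda>_. 1) p) < ereal (real r + 1)"
      unfolding \<mu>_def INF_less_iff by auto
    then show "\<exists>p. awalk v p u \<and> length p \<le> r"
      using cost by (intro exI[of _ p]) auto
  next
    assume "\<exists>p. awalk v p u \<and> length p \<le> r"
    then obtain p where p: "awalk v p u" "length p \<le> r" by blast
    have "\<mu> (\<lambda>_. 1) v u \<le> awalk_cost (\<lambda>_. 1) p"
      using p(1) by (rule min_cost_le_walk_cost)
    also have "\<dots> \<le> ereal (real r)" using p(2) cost by simp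
    finally show "\<mu> (\<lambda>_. 1) v u \<le> ereal (real r)" .
  }
qed

lemma closed_nbhd_iff:
  "u \<in> closed_nbhd G r v \<longleftrightarrow> (\<exists>p. awalk v p u \<and> length p \<le> r)"
  unfolding closed_nbhd_def using mu_le_iff_awalk by (auto dest: awalk_last_in_verts)

lemma closed_nbhd_0: "v \<in> verts G \<Longrightarrow> closed_nbhd G 0 v = {v}"
  by (auto simp: closed_nbhd_iff awalk_Nil_iff)

lemma closed_nbhd_Suc:
  "closed_nbhd G (Suc r) v = closed_nbhd G r v \<union> neighbours G (closed_nbhd G r v)"
proof (intro set_eqI iffI)
  fix w assume "w \<in> closed_nbhd G (Suc r) v"
  then obtain p where p: "awalk v p w" "length p \<le> Suc r" by (auto simp: closed_nbhd_iff)
  show "w \<in> closed_nbhd G r v \<union> neighbours G (closed_nbhd G r v)"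
  proof (cases "length p \<le> r")
    case True
    then show ?thesis using p by (auto simp: closed_nbhd_iff)
  next
    case False
    then obtain q a where q: "p = q @ [a]" using p(2) by (cases p rule: rev_cases) auto
    with p(1) obtain u where u: "awalk v q u" "awalk u [a] w" by (auto simp: awalk_append_iff)
    then have "u \<rightarrow>\<^bsub>G\<^esub> w" by (auto simp: awalk_Cons_iff awalk_Nil_iff arcs_ends_conv)
    moreover have "u \<in> closed_nbhd G r v" using u q p(2) by (auto simp: closed_nbhd_iff)
    ultimately show ?thesis by (auto simp: neighbours_def)
  qed
next
  fix w assume "w \<in> closed_nbhd G r v \<union> neighbours G (closed_nbhd G r v)"
  then consider "w \<in> closed_nbhd G r v" | u where "u \<in> closed_nbhd G r v" "u \<rightarrow>\<^bsub>G\<^esub> w"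
    by (auto simp: neighbours_def)
  then show "w \<in> closed_nbhd G (Suc r) v"
  proof cases
    case 1
    then show ?thesis by (auto simp: closed_nbhd_iff intro: le_SucI)
  next
    case 2
    then obtain p a where p: "awalk v p u" "length p \<le> r" and
      a: "a \<in> arcs G" "tail G a = u" "head G a = w"
      by (auto simp: closed_nbhd_iff arcs_ends_conv)
    have "awalk u [a] w" using a by (auto simp: awalk_Cons_iff awalk_Nil_iff)
    with p have "awalk v (p @ [a]) w" by (auto intro: awalk_appendI)
    with p(2) show ?thesis by (auto simp: closed_nbhd_iff intro!: exI[of _ "p @ [a]"])
  qed
qed

lemma on_fire_eq_covering:
  assumes "\<forall>i\<in>{1..k}. v i \<in> verts G"
  shows "on_fire G v k = (\<Union>i\<in>{1..k}. closed_nbhd G (k - i) (v i))"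
  using assms
proof (induction k)
  case 0
  then show ?case by simp
next
  case (Suc k)
  have IH: "on_fire G v k = (\<Union>i\<in>{1..k}. closed_nbhd G (k - i) (v i))"
    using Suc by auto
  have "neighbours G (\<Union>i\<in>{1..k}. closed_nbhd G (k - i) (v i)) =
      (\<Union>i\<in>{1..k}. neighbours G (closed_nbhd G (k - i) (v i)))"
    by (auto simp: neighbours_def)
  then have "on_fire G v (Suc k) =
      (\<Union>i\<in>{1..k}. closed_nbhd G (Suc (k - i)) (v i)) \<union> {v (Suc k)}"
    by (auto simp: IH closed_nbhd_Suc)
  also have "(\<Union>i\<in>{1..k}. closed_nbhd G (Suc (k - i)) (v i)) =
      (\<Union>i\<in>{1..k}. closed_nbhd G (Suc k - i) (v i))"
    by (intro SUP_cong refl) (auto simp: Suc_diff_le)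
  also have "{v (Suc k)} = closed_nbhd G (Suc k - Suc k) (v (Suc k))"
    using Suc.prems by (simp add: closed_nbhd_0)
  finally show ?case by (simp add: atLeastAtMostSuc_conv Un_commute)
qed

theorem burning_number_eq_covering:
  "burning_number G =
     (LEAST k. \<exists>v. (\<forall>i\<in>{1..k}. v i \<in> verts G) \<and>
        (\<Union>i\<in>{1..k}. closed_nbhd G (k - i) (v i)) = verts G)"
proof -
  have "(\<exists>v. (\<forall>i\<in>{1..k}. v i \<in> verts G) \<and> on_fire G v k = verts G) \<longleftrightarrow>
      (\<exists>v. (\<forall>i\<in>{1..k}. v i \<in> verts G) \<and>
        (\<Union>i\<in>{1..k}. closed_nbhd G (k - i) (v i)) = verts G)" for k
    using on_fire_eq_covering[of k] by (intro ex_cong1 conj_cong refl) simp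
  then show ?thesis unfolding burning_number_def by simp
qed

end

text \<open>The \<open>LEAST\<close> in \<open>burning_number\<close> is attained on every finite graph.\<close>

lemma (in fin_digraph) ex_burning_sequence:
  "\<exists>k v. (\<forall>i\<in>{1..k}. v i \<in> verts G) \<and> on_fire G v k = verts G"
proof -
  obtain v where v: "bij_betw v {1..card (verts G)} (verts G)"
    using ex_bij_betw_nat_finite_1[OF finite_verts] by (elim exE)
  let ?k = "card (verts G)"
  have mem: "\<forall>i\<in>{1..?k}. v i \<in> verts G" using v by (auto simp: bij_betw_def)
  have "w \<in> closed_nbhd G r w" if "w \<in> verts G" for w r
    unfolding closed_nbhd_iff using that by (intro exI[of _ "[]"]) (simp add: awalk_Nil_iff)
  then have "v ` {1..?k} \<subseteq> (\<Union>i\<in>{1..?k}. closed_nbhd G (?k - i) (v i))"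
    using mem by blast
  then have "verts G \<subseteq> (\<Union>i\<in>{1..?k}. closed_nbhd G (?k - i) (v i))"
    by (simp only: bij_betw_imp_surj_on[OF v])
  moreover have "(\<Union>i\<in>{1..?k}. closed_nbhd G (?k - i) (v i)) \<subseteq> verts G"
    by (auto simp: closed_nbhd_def)
  ultimately have "on_fire G v ?k = verts G"
    unfolding on_fire_eq_covering[OF mem] by (rule equalityI[rotated])
  with mem show ?thesis by (intro exI conjI)
qed

end

theory Submission
  imports Defs "HOL-Library.Sublist"
begin

text \<open>
  The statement proved by induction on \<open>A\<close> is that a rooted tree with \<open>n\<close> vertices is covered by balls
  of the distinct radii \<open>r \<in> A\<close> whenever \<open>n \<le> \<Sum>A + (card A)\<^sup>2 / 4\<close>; for \<open>A = {0..<k}\<close> the right-hand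
  side is about \<open>3 * k\<^sup>2 / 4\<close>. With \<open>N = card A\<close>, removing a subtree with at least \<open>r + N / 2\<close> vertices
  that fits into an \<open>r\<close>-ball keeps the inequality. If no subtree can be removed in this way, let
  \<open>p = Max A\<close> and let \<open>w\<close> be a lowest vertex at which two paths of total length more than \<open>2 * p\<close> meet.
  The subtrees \<open>C\<^sub>1\<close>, \<open>C\<^sub>2\<close> of \<open>w\<close> containing these paths have together more than \<open>2 * p\<close> vertices, and a
  \<open>p\<close>-ball covers them except for the bottom of \<open>C\<^sub>1\<close>, which fits into an \<open>r\<close>-ball for some smaller
  \<open>r \<in> A\<close>. For every \<open>q \<in> A\<close> that is not too large, the failure of \<open>q\<close> to remove a subtree forces a
  branch of about \<open>q - N / 2\<close> vertices off the longest path in \<open>C\<^sub>1\<close>. Because the elements of \<open>A\<close> are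
  distinct, there are a usable \<open>r\<close> and a \<open>q\<close> large enough for this extra branch to make \<open>C\<^sub>1 \<union> C\<^sub>2\<close> have
  at least \<open>p + r + N\<close> vertices, so \<open>p\<close> and \<open>r\<close> can be spent on it together.
\<close>

text \<open>
  A rooted tree is a prefix-closed set of lists: a list is the path from the root \<open>[]\<close> to a vertex,
  its length is the depth, and \<open>clen u v\<close> is the depth of the lowest common ancestor, so that
  \<open>tball\<close> is a ball in the tree metric. For \<open>m \<le> length l\<close>, \<open>cone W l m\<close> is the subtree hanging
  from the ancestor of \<open>l\<close> at depth \<open>m\<close>.
\<close>

definition prefix_closed :: "'a list set \<Rightarrow> bool" where
  "prefix_closed W \<longleftrightarrow> (\<forall>u\<in>W. \<forall>n. take n u \<in> W)"

definition clen :: "'a list \<Rightarrow> 'a list \<Rightarrow> nat" where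
  "clen u v = length (longest_common_prefix u v)"

definition cone :: "'a list set \<Rightarrow> 'a list \<Rightarrow> nat \<Rightarrow> 'a list set" where
  "cone W l m = {u\<in>W. m \<le> clen u l}"

definition tball :: "'a list \<Rightarrow> nat \<Rightarrow> 'a list set" where
  "tball c r = {u. length u + length c \<le> 2 * clen u c + r}"

section \<open>Lowest common ancestors and balls in a list tree\<close>

lemma le_clen_iff: "n \<le> clen u v \<longleftrightarrow> n \<le> length u \<and> n \<le> length v \<and> take n u = take n v"
proof
  let ?q = "longest_common_prefix u v"
  assume n: "n \<le> clen u v"
  have "prefix ?q u" "prefix ?q v"
    by (rule longest_common_prefix_prefix1 longest_common_prefix_prefix2)+
  then obtain x y where u: "u = ?q @ x" and v: "v = ?q @ y"
    by (auto elim!: prefixE)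
  have "take n u = take n ?q" "take n v = take n ?q"
    using arg_cong[OF u, of "take n"] arg_cong[OF v, of "take n"] n by (simp_all add: clen_def)
  moreover have "length ?q \<le> length u" "length ?q \<le> length v"
    by (intro prefix_length_le longest_common_prefix_prefix1 longest_common_prefix_prefix2)+
  ultimately show "n \<le> length u \<and> n \<le> length v \<and> take n u = take n v"
    using n by (simp add: clen_def)
next
  assume n: "n \<le> length u \<and> n \<le> length v \<and> take n u = take n v"
  then have "prefix (take n u) (longest_common_prefix u v)"
    by (metis longest_common_prefix_max_prefix take_is_prefix)
  then show "n \<le> clen u v"
    using n prefix_length_le unfolding clen_def by fastforce
qed

lemma clen_commute: "clen u v = clen v u"
  using le_clen_iff[of _ u v] le_clen_iff[of _ v u] by (metis order_antisym order_refl)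

lemma clen_le: "clen u v \<le> length u" "clen u v \<le> length v"
  using le_clen_iff[of "clen u v" u v] by auto

lemma clen_take_left: "clen (take n u) v = min n (clen u v)"
proof (rule order_antisym)
  have "clen (take n u) v \<le> n" using clen_le(1)[of "take n u" v] by simp
  moreover have "clen (take n u) v \<le> clen u v"
    using le_clen_iff[of "clen (take n u) v" "take n u" v] by (simp add: le_clen_iff min_def split: if_splits)
  ultimately show "clen (take n u) v \<le> min n (clen u v)" by simp
  have "k \<le> clen (take n u) v" if "k \<le> n" "k \<le> clen u v" for k
    using that unfolding le_clen_iff by (simp add: min_absorb1)
  then show "min n (clen u v) \<le> clen (take n u) v" by simp
qed

lemma clen_refl [simp]: "clen u u = length u"
  using clen_le(1)[of u u] le_clen_iff[of "length u" u u] by simp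

lemma clen_ultrametric: "m \<le> clen u v \<Longrightarrow> m \<le> clen v x \<Longrightarrow> m \<le> clen u x"
  by (auto simp: le_clen_iff)

lemma mem_tballI:
  "m \<le> clen u c \<Longrightarrow> length u + length c \<le> 2 * m + r \<Longrightarrow> u \<in> tball c r"
  by (auto simp: tball_def)

lemma prefix_closed_take: "prefix_closed W \<Longrightarrow> u \<in> W \<Longrightarrow> take n u \<in> W"
  by (auto simp: prefix_closed_def)

lemma cone_subset: "cone W l m \<subseteq> W"
  by (auto simp: cone_def)

lemma prefix_closed_Diff_cone: "prefix_closed W \<Longrightarrow> prefix_closed (W - cone W l m)"
  by (auto simp: prefix_closed_def cone_def clen_take_left)

text \<open>A vertex leaving the path to \<open>l\<close> at or below the centre is near because
  \<open>l\<close> is deepest. One leaving above has distance at most \<open>2 * r\<close> to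
  \<open>l\<close>, and the centre is \<open>r\<close> closer. If \<open>r\<close> exceeds
  \<open>length l\<close>, the centre is the root.\<close>

lemma subset_tball_on_spine:
  assumes "\<And>u. u \<in> S \<Longrightarrow> length u \<le> length l"
    and "\<And>u. u \<in> S \<Longrightarrow> length u + length l \<le> 2 * clen u l + 2 * r"
  shows "S \<subseteq> tball (take (length l - r) l) r"
proof
  fix u assume u: "u \<in> S"
  have "clen u (take (length l - r) l) = min (length l - r) (clen u l)"
    using clen_take_left[of "length l - r" l u] by (simp add: clen_commute)
  then show "u \<in> tball (take (length l - r) l) r"
    using assms[OF u] by (auto simp: tball_def min_def)
qed

section \<open>Counting the vertices of a cone along a path\<close>

lemma length_diff_less_card_level:
  assumes "prefix_closed W" "finite W" "u \<in> W" "clen u l = i"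
  shows "length u - i < card {v\<in>W. clen v l = i}"
proof -
  have i: "i \<le> length u" using assms(4) clen_le by blast
  have "inj_on (\<lambda>n. take n u) {i..length u}"
    by (rule inj_on_inverseI[where g = length]) simp
  then have "Suc (length u - i) = card ((\<lambda>n. take n u) ` {i..length u})"
    using i by (simp add: card_image Suc_diff_le)
  also have "\<dots> \<le> card {v\<in>W. clen v l = i}"
    using assms by (intro card_mono) (auto simp: clen_take_left prefix_closed_take)
  finally show ?thesis by simp
qed

lemma card_cone_eq_sum_levels:
  assumes "finite W"
  shows "card (cone W l m) = (\<Sum>i=m..length l. card {v\<in>W. clen v l = i})"
proof -
  have "cone W l m = (\<Union>i\<in>{m..length l}. {v\<in>W. clen v l = i})"
    using clen_le(2) by (auto simp: cone_def)
  then show ?thesis using assms by (simp add: card_UN_disjoint disjoint_iff)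
qed

text \<open>Each level has one vertex on the path itself; these give the first summand, and the
  levels in \<open>I\<close> add their remaining vertices.\<close>

lemma card_cone_ge_levels:
  assumes "prefix_closed W" "finite W" "l \<in> W" "I \<subseteq> {m..length l}"
  shows "Suc (length l) - m + (\<Sum>i\<in>I. card {v\<in>W. clen v l = i} - 1) \<le> card (cone W l m)"
proof -
  let ?\<beta> = "\<lambda>i. card {v\<in>W. clen v l = i}"
  have pos: "1 \<le> ?\<beta> i" if "i \<in> {m..length l}" for i
    using length_diff_less_card_level[OF assms(1,2) prefix_closed_take[OF assms(1,3), of i], of l i] that
    by (simp add: clen_take_left)
  have "(\<Sum>i\<in>I. ?\<beta> i - 1) \<le> (\<Sum>i=m..length l. ?\<beta> i - 1)"
    using assms(4) by (intro sum_mono2) auto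
  moreover have "(\<Sum>i=m..length l. ?\<beta> i) = (\<Sum>i=m..length l. 1 + (?\<beta> i - 1))"
    by (intro sum.cong refl le_add_diff_inverse[OF pos, symmetric])
  then have "(\<Sum>i=m..length l. ?\<beta> i) = Suc (length l) - m + (\<Sum>i=m..length l. ?\<beta> i - 1)"
    by (simp only: sum.distrib) simp
  ultimately show ?thesis using card_cone_eq_sum_levels[OF assms(2)] by simp
qed

text \<open>
  The vertices \<open>v\<close> with \<open>clen v l = m\<close> are those leaving the path to \<open>l\<close> at depth \<open>m\<close>. The branch
  found here is the deepest one that prevents a ball centred on the path from swallowing everything
  below it; since the cone just below that branch is small, the branch itself must be long.
\<close>

lemma exists_deep_branch:
  assumes W: "prefix_closed W" "finite W" and l: "l \<in> W"
    and top: "\<And>u. u \<in> cone W l (Suc k) \<Longrightarrow> length u \<le> length l"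
    and no_single: "\<And>m c. c \<in> W \<Longrightarrow> cone W l m \<subseteq> tball c r \<Longrightarrow> card (cone W l m) < r + E"
    and r: "r + E + k \<le> length l"
  shows "\<exists>m. k < m \<and> m + r < length l \<and> r + 2 \<le> E + (card {v\<in>W. clen v l = m} - 1)"
proof -
  define Z where
    "Z = {m. k < m \<and> (\<exists>u\<in>W. clen u l = m \<and> 2 * m + 2 * r < length u + length l)}"
  have Zsub: "Z \<subseteq> {..length l}" unfolding Z_def using clen_le(2) by fastforce
  then have fin: "finite Z" using finite_subset by blast
  have single: "card (cone W l m) < r + E"
    if "k < m" "\<forall>m'\<in>Z. m' < m" for m
  proof (rule no_single)
    show "take (length l - r) l \<in> W" using W(1) l by (rule prefix_closed_take)
    show "cone W l m \<subseteq> tball (take (length l - r) l) r"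
    proof (rule subset_tball_on_spine)
      fix u assume "u \<in> cone W l m"
      then have u: "u \<in> W" "m \<le> clen u l" by (auto simp: cone_def)
      with \<open>k < m\<close> show "length u \<le> length l" by (intro top) (auto simp: cone_def)
      have "clen u l \<notin> Z" using u(2) that(2) by fastforce
      then show "length u + length l \<le> 2 * clen u l + 2 * r"
        using u that(1) by (fastforce simp: Z_def)
    qed
  qed
  have size: "Suc (length l) - m \<le> card (cone W l m)" for m
    using card_cone_ge_levels[OF W l, of "{}" m] by simp
  \<comment> \<open>Otherwise one ball takes the whole cone at depth \<open>Suc k\<close>, whose
    path alone has at least \<open>r + E\<close> vertices.\<close>
  have "Z \<noteq> {}"
    using single[of "Suc k"] size[of "Suc k"] r by auto
  define m where "m = Max Z"
  have "m \<in> Z" unfolding m_def using fin \<open>Z \<noteq> {}\<close> by simp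
  then obtain u where u: "u \<in> W" "clen u l = m" "k < m" "2 * m + 2 * r < length u + length l"
    by (auto simp: Z_def)
  have "length u \<le> length l" using u by (intro top) (auto simp: cone_def)
  then have mr: "m + r < length l" using u(4) by simp
  have "\<forall>m'\<in>Z. m' < Suc m" using fin by (auto simp: m_def less_Suc_eq_le)
  then have "length l - m < r + E"
    using single[of "Suc m"] size[of "Suc m"] u(3) by simp
  moreover have "length u - m < card {v\<in>W. clen v l = m}"
    using length_diff_less_card_level[OF W u(1,2)] .
  ultimately have "r + 2 \<le> E + (card {v\<in>W. clen v l = m} - 1)"
    using u(4) mr by linarith
  then show ?thesis using u(3) mr by blast
qed

section \<open>Spending two radii together\<close>

lemma two_ball_step:
  fixes A :: "nat set" and W :: "'a list set"
  assumes W: "prefix_closed W" "finite W" and A: "finite A" and p: "p \<in> A" "\<forall>r\<in>A. r \<le> p"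
    and E: "card A \<le> 2 * E" "2 * E \<le> Suc (card A)"
    and far: "a\<^sub>0 \<in> W" "b\<^sub>0 \<in> W" "2 * clen a\<^sub>0 b\<^sub>0 + 2 * p < length a\<^sub>0 + length b\<^sub>0"
    and no_single: "\<forall>r\<in>A. \<forall>l\<in>W. \<forall>c\<in>W. \<forall>m. cone W l m \<subseteq> tball c r \<longrightarrow>
      card (cone W l m) < r + E"
  shows "\<exists>r\<in>A - {p}. \<exists>l\<^sub>1 m\<^sub>1 l\<^sub>2 m\<^sub>2. \<exists>c\<in>W. \<exists>c'\<in>W.
    cone W l\<^sub>1 m\<^sub>1 \<union> cone W l\<^sub>2 m\<^sub>2 \<subseteq> tball c p \<union> tball c' r \<and>
    p + r + card A \<le> card (cone W l\<^sub>1 m\<^sub>1 \<union> cone W l\<^sub>2 m\<^sub>2)"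
proof -
  define N where "N = card A"
  define P where "P = {(u, v). u \<in> W \<and> v \<in> W \<and> 2 * clen u v + 2 * p < length u + length v}"
  have finP: "finite P" by (rule finite_subset[of _ "W \<times> W"]) (auto simp: P_def W)
  have "P \<noteq> {}" using far by (auto simp: P_def)
  \<comment> \<open>\<open>k\<close> is the depth of the lowest vertex joining two vertices too far apart for a \<open>p\<close>-ball.\<close>
  define k where "k = Max ((\<lambda>(u, v). clen u v) ` P)"
  have "k \<in> (\<lambda>(u, v). clen u v) ` P"
    unfolding k_def using finP \<open>P \<noteq> {}\<close> by (intro Max_in) auto
  then obtain a b\<^sub>1 where ab: "a \<in> W" "b\<^sub>1 \<in> W" "2 * k + 2 * p < length a + length b\<^sub>1" "clen a b\<^sub>1 = k"
    by (auto simp: P_def)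
  have near: "length u + length v \<le> 2 * clen u v + 2 * p" if "u \<in> W" "v \<in> W" "k < clen u v" for u v
  proof (rule ccontr)
    assume "\<not> ?thesis"
    then have "clen u v \<in> (\<lambda>(u, v). clen u v) ` P" using that by (force simp: P_def)
    then have "clen u v \<le> k" unfolding k_def using finP by (intro Max_ge) auto
    with that show False by simp
  qed

  have fincone: "finite (cone W x m)" for x m using W by (auto simp: cone_def)
  obtain l where l: "l \<in> cone W a k" and l_max: "\<And>u. u \<in> cone W a k \<Longrightarrow> length u \<le> length l"
  proof -
    have "a \<in> cone W a k" using ab clen_le(1)[of a b\<^sub>1] by (auto simp: cone_def)
    then have "Max (length ` cone W a k) \<in> length ` cone W a k"
      using fincone by (intro Max_in) auto
    then obtain l where "l \<in> cone W a k" "length l = Max (length ` cone W a k)" by auto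
    with fincone that show thesis by (metis Max_ge finite_imageI imageI)
  qed
  have lW: "l \<in> W" using l by (simp add: cone_def)
  have below_l: "length u \<le> length l" if "u \<in> W" "k \<le> clen u l" for u
    using that l by (intro l_max) (auto simp: cone_def intro: clen_ultrametric)
  have kl: "k \<le> clen a l" "k \<le> clen b\<^sub>1 l"
    using l clen_ultrametric[of k b\<^sub>1 a l] ab(4) by (auto simp: cone_def clen_commute)
  have la: "length a \<le> length l" "length b\<^sub>1 \<le> length l" using kl ab by (auto intro: below_l)
  define S where "S = {u\<in>W. clen u l = k}"
  \<comment> \<open>As \<open>a\<close> and \<open>b\<^sub>1\<close> part at depth \<open>k\<close>,
    one of them leaves the path to \<open>l\<close> there; \<open>l\<close>, being at least as deep,
    replaces the other.\<close>
  have "\<exists>b\<in>S. 2 * k + 2 * p < length b + length l"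
  proof (cases "clen b\<^sub>1 l = k")
    case True
    then show ?thesis using ab la by (auto simp: S_def)
  next
    case False
    then have "Suc k \<le> clen b\<^sub>1 l" using kl by simp
    then have "clen a l = k"
      using clen_ultrametric[of "Suc k" a l b\<^sub>1] clen_commute[of b\<^sub>1 l] ab(4) kl
      by linarith
    then show ?thesis using ab la by (auto simp: S_def intro!: bexI[of _ a])
  qed
  then obtain b\<^sub>2 where b2: "b\<^sub>2 \<in> S" "2 * k + 2 * p < length b\<^sub>2 + length l" by auto
  have finS: "finite S" using W by (auto simp: S_def)
  then have "Max (length ` S) \<in> length ` S" using b2 by (intro Max_in) auto
  then obtain b where bS: "b \<in> S" and b_len: "length b = Max (length ` S)" by auto
  have b_max: "length u \<le> length b" if "u \<in> S" for u
    unfolding b_len using that finS by auto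
  have b: "b \<in> W" "clen b l = k" using bS by (auto simp: S_def)
  have bl: "2 * k + 2 * p < length b + length l" using b2 b_max[OF b2(1)] by simp
  have ble: "length b \<le> length l" using b by (intro below_l) auto
  have kb: "k \<le> length b" using b clen_le(1)[of b l] by simp

  define h where "h = length l - k"
  define h\<^sub>2 where "h\<^sub>2 = length b - k"
  have h: "length l = k + h" "length b = k + h\<^sub>2" "h\<^sub>2 \<le> h" "2 * p < h + h\<^sub>2"
    using ble kb bl by (auto simp: h_def h\<^sub>2_def)
  define s where "s = h - p"
  have hs: "h = p + s" "1 \<le> s" using h by (auto simp: s_def)
  \<comment> \<open>Truncation matters: if \<open>h\<^sub>2 \<le> p\<close>, the ball is centred at
    the meeting vertex itself.\<close>
  define \<sigma> where "\<sigma> = h\<^sub>2 - p"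
  define \<gamma> where "\<gamma> m = card {v\<in>W. clen v l = m} - 1" for m

  define C\<^sub>1 where "C\<^sub>1 = cone W l (Suc k)"
  define C\<^sub>2 where "C\<^sub>2 = cone W b (Suc k)"
  have near_l: "length u + length l \<le> 2 * clen u l + 2 * p" "length u \<le> length l"
    if "u \<in> C\<^sub>1" for u
    using that near[of u l] below_l[of u] lW by (auto simp: C\<^sub>1_def cone_def)
  \<comment> \<open>By maximality of \<open>k\<close> one \<open>p\<close>-ball covers
    \<open>C\<^sub>1\<close>, so \<open>no_single\<close> bounds its size from above.\<close>
  have "C\<^sub>1 \<subseteq> tball (take (length l - p) l) p"
    by (rule subset_tball_on_spine) (auto dest: near_l)
  then have C1_lt: "card C\<^sub>1 < p + E"
    unfolding C\<^sub>1_def using no_single p(1) lW prefix_closed_take[OF W(1) lW] by blast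
  have C1_ge: "h + (\<Sum>i\<in>I. \<gamma> i) \<le> card C\<^sub>1" if "I \<subseteq> {Suc k..length l}" for I
    using card_cone_ge_levels[OF W lW that] h(1) by (simp add: C\<^sub>1_def \<gamma>_def)

  \<comment> \<open>The \<open>p\<close>-ball will be centred \<open>\<sigma>\<close> steps down the path to \<open>b\<close>, so as to swallow \<open>C\<^sub>2\<close>. What it
    misses of \<open>C\<^sub>1\<close> lies below depth \<open>m\<^sub>1\<close> on the path to \<open>l\<close>, hence in a ball of radius \<open>J\<close>.\<close>
  define Y where "Y = {m. k < m \<and> (\<exists>u\<in>W. clen u l = m \<and> p + k < length u + \<sigma>)}"
  define m\<^sub>1 where "m\<^sub>1 = (LEAST m. m \<in> Y)"
  have "length l \<in> Y" using lW h hs by (auto simp: Y_def intro!: bexI[of _ l])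
  then have m1Y: "m\<^sub>1 \<in> Y" unfolding m\<^sub>1_def by (rule LeastI)
  have m1_le: "m\<^sub>1 \<le> m" if "m \<in> Y" for m unfolding m\<^sub>1_def using that by (rule Least_le)
  obtain u\<^sub>1 where u1: "u\<^sub>1 \<in> W" "clen u\<^sub>1 l = m\<^sub>1" "k < m\<^sub>1" "p + k < length u\<^sub>1 + \<sigma>"
    using m1Y by (auto simp: Y_def)
  have m1l: "m\<^sub>1 \<le> length l" using u1 clen_le(2)[of u\<^sub>1 l] by simp
  define J where "J = length l - m\<^sub>1"
  have "length u\<^sub>1 - m\<^sub>1 \<le> \<gamma> m\<^sub>1"
    using length_diff_less_card_level[OF W u1(1,2)] by (simp add: \<gamma>_def)
  then have g1: "J + 1 \<le> s + \<sigma> + \<gamma> m\<^sub>1" using u1(4) m1l h hs by (simp add: J_def)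
  have "h + \<gamma> m\<^sub>1 < p + E" using C1_ge[of "{m\<^sub>1}"] C1_lt u1 m1l by simp
  then have sg: "s + \<gamma> m\<^sub>1 < E" using hs by simp
  have \<sigma>s: "\<sigma> \<le> s" using h hs by (auto simp: \<sigma>_def)
  have J: "J + 2 \<le> E + s" using g1 sg \<sigma>s by simp

  have "A \<subseteq> {0..p}" using p(2) by auto
  then have Np: "N \<le> p + 1" unfolding N_def using card_mono[of "{0..p}" A] by simp
  have N1: "1 \<le> N" unfolding N_def using p A by (auto simp: Suc_le_eq card_gt_0_iff)
  note EN = E[folded N_def]
  \<comment> \<open>\<open>C\<^sub>1\<close> has at least \<open>h\<close> vertices, so no ball with radius in \<open>L\<close> covers it, by \<open>no_single\<close>. As \<open>L\<close>
    consists of many distinct numbers, its largest element exceeds its smallest usable one by far.\<close>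
  define L where "L = {r\<in>A. r + E \<le> h}"
  \<comment> \<open>By \<open>h = p + s\<close> this interval has \<open>E - s\<close> elements;
    \<open>N \<le> p + 1\<close> keeps \<open>Suc h - E\<close> from truncating.\<close>
  have "A - L \<subseteq> {Suc h - E..p}" using p(2) by (auto simp: L_def)
  then have "card (A - L) \<le> Suc p - (Suc h - E)" using card_mono[of "{Suc h - E..p}"] by fastforce
  then have "card (A - L) \<le> E - s" using hs sg EN Np N1 by simp
  moreover have "card (A - L) = N - card L" "card L \<le> N"
    unfolding N_def using A by (auto simp: L_def card_Diff_subset intro: card_mono)
  ultimately have Lcard: "N + s \<le> card L + E" using sg by linarith
  define L' where "L' = {r\<in>L. J \<le> r}"
  have finL: "finite L" "finite L'" using A by (auto simp: L_def L'_def)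
  have "L \<subseteq> L' \<union> {0..<J}" by (auto simp: L'_def)
  then have "card L \<le> card L' + J"
    using card_mono[of "L' \<union> {0..<J}" L] card_Un_le[of L' "{0..<J}"] finL by simp
  then have L'card: "N + s \<le> card L' + J + E" using Lcard by simp
  then have "L' \<noteq> {}" using J EN by (cases "L' = {}") auto
  \<comment> \<open>The small radius \<open>r\<close> is spent, while \<open>q\<close> is only
    tested: its failure yields a long branch.\<close>
  define r where "r = Min L'"
  define q where "q = Max L'"
  have rL: "r \<in> L'" and qL: "q \<in> L'" using finL \<open>L' \<noteq> {}\<close> by (auto simp: r_def q_def)
  have "L' \<subseteq> {r..q}" using finL by (auto simp: r_def q_def)
  then have "card L' \<le> Suc q - r" using card_mono[of "{r..q}" L'] by simp
  then have rq: "N + s + r \<le> Suc q + J + E" using L'card rL qL \<open>L' \<subseteq> {r..q}\<close> by fastforce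
  have r: "r \<in> A" "r + E \<le> h" "J \<le> r" and q: "q \<in> A" "q + E \<le> h" "J \<le> q"
    using rL qL by (auto simp: L'_def L_def)
  have "r \<noteq> p" using r(2) hs sg by auto

  have "\<exists>m. k < m \<and> m + q < length l \<and> q + 2 \<le> E + \<gamma> m"
    unfolding \<gamma>_def
  proof (rule exists_deep_branch[OF W lW])
    show "length u \<le> length l" if "u \<in> cone W l (Suc k)" for u
      using that near_l(2) by (simp add: C\<^sub>1_def)
    show "card (cone W l m) < q + E" if "c \<in> W" "cone W l m \<subseteq> tball c q" for m c
      using no_single q(1) lW that by blast
    show "q + E + k \<le> length l" using q h by simp
  qed
  then obtain m\<^sub>2 where m2: "k < m\<^sub>2" "m\<^sub>2 + q < length l" "q + 2 \<le> E + \<gamma> m\<^sub>2" by auto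
  \<comment> \<open>As \<open>q \<ge> J\<close>, the branch forced by \<open>q\<close> leaves
    strictly above depth \<open>m\<^sub>1\<close>, so both branches count separately.\<close>
  have "m\<^sub>2 < m\<^sub>1" using m2(2) q(3) by (simp add: J_def)
  then have C1: "h + \<gamma> m\<^sub>1 + \<gamma> m\<^sub>2 \<le> card C\<^sub>1"
    using C1_ge[of "{m\<^sub>1, m\<^sub>2}"] m2 u1 m1l by simp
  have C2: "h\<^sub>2 \<le> card C\<^sub>2"
    using card_cone_ge_levels[OF W b(1), of "{}" "Suc k"] h by (simp add: C\<^sub>2_def)
  have disj: "C\<^sub>1 \<inter> C\<^sub>2 = {}"
  proof -
    have "Suc k \<le> clen b l" if "u \<in> C\<^sub>1" "u \<in> C\<^sub>2" for u
      using that clen_ultrametric[of "Suc k" b u l] by (simp add: C\<^sub>1_def C\<^sub>2_def cone_def clen_commute)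
    then show ?thesis using b by auto
  qed
  \<comment> \<open>Adding the lower bounds cancels \<open>J\<close>, \<open>s\<close> and
    \<open>\<sigma>\<close> and leaves \<open>2 * p + r + N + 3 - 2 * E\<close>, where
    \<open>2 * E \<le> N + 1 \<le> p + 2\<close>.\<close>
  have "p + r + N \<le> card C\<^sub>1 + card C\<^sub>2"
  proof -
    have "p + \<sigma> < h\<^sub>2 + s" using h hs by (auto simp: \<sigma>_def)
    then show ?thesis using C1 C2 g1 m2(3) rq EN Np hs by linarith
  qed
  also have "card C\<^sub>1 + card C\<^sub>2 = card (C\<^sub>1 \<union> C\<^sub>2)"
    using disj fincone by (simp add: card_Un_disjoint C\<^sub>1_def C\<^sub>2_def)
  finally have size: "p + r + N \<le> card (C\<^sub>1 \<union> C\<^sub>2)" .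

  define c where "c = take (k + \<sigma>) b"
  have c_len: "length c = k + \<sigma>" using h by (simp add: c_def \<sigma>_def)
  have clen_c: "clen u c = min (k + \<sigma>) (clen u b)" for u
    unfolding c_def using clen_take_left[of "k + \<sigma>" b u] by (simp add: clen_commute)
  have in_C2: "u \<in> W" "Suc k \<le> clen u b" "length u \<le> length b" if "u \<in> C\<^sub>2" for u
  proof -
    show uW: "u \<in> W" "Suc k \<le> clen u b" using that by (auto simp: C\<^sub>2_def cone_def)
    have "clen u l = k"
    proof (rule order_antisym)
      have "u \<notin> C\<^sub>1" using that disj by auto
      then show "clen u l \<le> k" using uW by (simp add: C\<^sub>1_def cone_def)
      show "k \<le> clen u l" using uW b clen_ultrametric[of k u b l] by simp
    qed
    then show "length u \<le> length b" using uW by (intro b_max) (simp add: S_def)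
  qed
  have "C\<^sub>2 \<subseteq> tball c p"
  proof (cases "p \<le> h\<^sub>2")
    case True
    have "length u + length b \<le> 2 * clen u b + 2 * p" if "u \<in> C\<^sub>2" for u
      using near[of u b] in_C2[OF that] b by simp
    with in_C2(3) have "C\<^sub>2 \<subseteq> tball (take (length b - p) b) p"
      by (rule subset_tball_on_spine)
    then show ?thesis using True h by (simp add: c_def \<sigma>_def)
  next
    case False
    show ?thesis
    proof
      fix u assume "u \<in> C\<^sub>2"
      from in_C2[OF this] show "u \<in> tball c p"
        using False h c_len by (intro mem_tballI[of k]) (auto simp: clen_c \<sigma>_def)
    qed
  qed
  moreover have "C\<^sub>1 \<subseteq> tball c p \<union> tball (take m\<^sub>1 l) r"
  proof
    fix u assume u: "u \<in> C\<^sub>1"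
    then have uW: "u \<in> W" "k < clen u l" by (auto simp: C\<^sub>1_def cone_def)
    show "u \<in> tball c p \<union> tball (take m\<^sub>1 l) r"
    proof (cases "length u + \<sigma> \<le> p + k")
      case True
      have "k \<le> clen u b" using clen_ultrametric[of k u l b] uW b by (simp add: clen_commute)
      then have "u \<in> tball c p"
        using True c_len by (intro mem_tballI[of k]) (auto simp: clen_c)
      then show ?thesis by simp
    next
      case False
      then have "m\<^sub>1 \<le> clen u l" using uW by (intro m1_le) (auto simp: Y_def)
      then have "u \<in> tball (take m\<^sub>1 l) r"
        using near_l(2)[OF u] m1l r(3) clen_take_left[of m\<^sub>1 l u]
        by (intro mem_tballI[of m\<^sub>1]) (auto simp: clen_commute J_def)
      then show ?thesis by simp
    qed
  qed
  ultimately have "C\<^sub>1 \<union> C\<^sub>2 \<subseteq> tball c p \<union> tball (take m\<^sub>1 l) r" by blast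
  moreover have "c \<in> W" "take m\<^sub>1 l \<in> W" using W b lW by (auto simp: c_def prefix_closed_take)
  ultimately show ?thesis
    using size r(1) \<open>r \<noteq> p\<close> unfolding N_def C\<^sub>1_def C\<^sub>2_def by blast
qed

section \<open>Induction on the set of radii\<close>

lemma exists_ball_cover:
  assumes "prefix_closed W" "finite W" "finite A" "4 * card W \<le> 4 * \<Sum>A + (card A)\<^sup>2"
  shows "\<exists>c. (\<forall>r\<in>A. c r \<in> insert [] W) \<and> W \<subseteq> (\<Union>r\<in>A. tball (c r) r)"
  using assms(3,1,2,4)
proof (induction A arbitrary: W rule: finite_psubset_induct)
  case (psubset A W)
  note W = psubset.prems(1,2) and card_W = psubset.prems(3)
  \<comment> \<open>Spending one radius lowers \<open>(card A)\<^sup>2 / 4\<close> by less than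
    \<open>card A / 2\<close>, which \<open>E\<close> rounds up; spending two lowers it by
    \<open>card A - 1\<close>.\<close>
  define E where "E = Suc (card A) div 2"
  have E: "card A \<le> 2 * E" "2 * E \<le> Suc (card A)" by (auto simp: E_def)
  have extend: "\<exists>c. (\<forall>r\<in>A. c r \<in> insert [] W) \<and> W \<subseteq> (\<Union>r\<in>A. tball (c r) r)"
    if R: "R \<subseteq> A" "R \<noteq> {}" and X: "X \<subseteq> (\<Union>r\<in>R. tball (d r) r)" "prefix_closed (W - X)" "X \<subseteq> W"
      and d: "\<forall>r\<in>R. d r \<in> W" and size: "4 * \<Sum>R + (card A)\<^sup>2 \<le> 4 * card X + (card (A - R))\<^sup>2" for R X d
  proof -
    have fin: "finite R" "finite X" using R X W psubset.hyps(1) finite_subset by blast+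
    have "\<Sum>A = \<Sum>(A - R) + \<Sum>R" using R psubset.hyps(1) by (simp add: sum.subset_diff)
    moreover have "card W = card (W - X) + card X"
      using X(3) fin W(2) by (simp add: card_Diff_subset card_mono)
    ultimately have "4 * card (W - X) \<le> 4 * \<Sum>(A - R) + (card (A - R))\<^sup>2"
      using card_W size by linarith
    moreover have "A - R \<subset> A" using R by auto
    ultimately obtain c where c: "\<forall>r\<in>A - R. c r \<in> insert [] (W - X)"
      "W - X \<subseteq> (\<Union>r\<in>A - R. tball (c r) r)"
      using psubset.IH[of "A - R" "W - X"] X(2) W(2) by auto
    let ?c = "\<lambda>r. if r \<in> R then d r else c r"
    have "\<forall>r\<in>A. ?c r \<in> insert [] W" using c(1) d by auto
    moreover have "W \<subseteq> (\<Union>r\<in>A. tball (?c r) r)"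
    proof
      fix u assume u: "u \<in> W"
      show "u \<in> (\<Union>r\<in>A. tball (?c r) r)"
      proof (cases "u \<in> X")
        case True
        then obtain r where "r \<in> R" "u \<in> tball (d r) r" using X(1) by auto
        then show ?thesis using R(1) by (auto intro!: bexI[of _ r])
      next
        case False
        then obtain r where "r \<in> A - R" "u \<in> tball (c r) r" using c(2) u by auto
        then show ?thesis by (auto intro!: bexI[of _ r])
      qed
    qed
    ultimately show ?thesis by (intro exI[of _ ?c] conjI)
  qed
  consider "W = {}" | "W \<noteq> {}" "A = {}" | "W \<noteq> {}" "A \<noteq> {}" by blast
  then show ?case
  proof cases
    case 1
    \<comment> \<open>With no vertex left, the remaining radii get the default centre
      \<open>[]\<close>.\<close>
    then show ?thesis by (intro exI[of _ "\<lambda>_. []"]) auto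
  next
    case 2
    then show ?thesis using card_W W by simp
  next
    case 3
    define p where "p = Max A"
    have p: "p \<in> A" "\<forall>r\<in>A. r \<le> p" using 3 psubset.hyps(1) by (auto simp: p_def)
    show ?thesis
    proof (cases "\<exists>u\<in>W. \<exists>v\<in>W. 2 * clen u v + 2 * p < length u + length v")
      case False
      have "Max (length ` W) \<in> length ` W" using 3 W by (intro Max_in) auto
      then obtain l where l: "l \<in> W" "length l = Max (length ` W)" by auto
      have l_max: "length u \<le> length l" if "u \<in> W" for u using that W(2) l(2) by simp
      have "W \<subseteq> tball (take (length l - p) l) p"
        using False l(1) l_max by (intro subset_tball_on_spine) (auto simp: not_less)
      then have "W \<subseteq> (\<Union>r\<in>A. tball (take (length l - p) l) r)" using p(1) by blast
      then show ?thesis using W l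
        by (intro exI[of _ "\<lambda>_. take (length l - p) l"]) (auto simp: prefix_closed_take)
    next
      case far: True
      show ?thesis
      proof (cases "\<exists>r\<in>A. \<exists>l m. \<exists>c\<in>W. cone W l m \<subseteq> tball c r \<and> r + E \<le> card (cone W l m)")
        case True
        then obtain r l m c where *: "r \<in> A" "c \<in> W" "cone W l m \<subseteq> tball c r"
          "r + E \<le> card (cone W l m)" by blast
        obtain n where n: "card A = Suc n" "card (A - {r}) = n"
          using *(1) psubset.hyps(1) by (metis card_Suc_Diff1)
        have "4 * r + (card A)\<^sup>2 \<le> 4 * card (cone W l m) + (card (A - {r}))\<^sup>2"
          using *(4) E(1) n by (simp add: power2_eq_square)
        then show ?thesis using * W
          by (intro extend[of "{r}" "cone W l m" "\<lambda>_. c"])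
            (auto simp: prefix_closed_Diff_cone cone_subset)
      next
        case False
        then have no_single: "\<forall>r\<in>A. \<forall>l\<in>W. \<forall>c\<in>W. \<forall>m. cone W l m \<subseteq> tball c r \<longrightarrow>
            card (cone W l m) < r + E"
          by (meson not_le)
        from far obtain u v where uv: "u \<in> W" "v \<in> W" "2 * clen u v + 2 * p < length u + length v"
          by blast
        obtain r l\<^sub>1 m\<^sub>1 l\<^sub>2 m\<^sub>2 c c' where *: "r \<in> A" "r \<noteq> p" "c \<in> W" "c' \<in> W"
          "cone W l\<^sub>1 m\<^sub>1 \<union> cone W l\<^sub>2 m\<^sub>2 \<subseteq> tball c p \<union> tball c' r"
          "p + r + card A \<le> card (cone W l\<^sub>1 m\<^sub>1 \<union> cone W l\<^sub>2 m\<^sub>2)"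
          using two_ball_step[OF W psubset.hyps(1) p E uv no_single] by blast
        let ?X = "cone W l\<^sub>1 m\<^sub>1 \<union> cone W l\<^sub>2 m\<^sub>2"
        have "W - ?X = (W - cone W l\<^sub>1 m\<^sub>1) - cone (W - cone W l\<^sub>1 m\<^sub>1) l\<^sub>2 m\<^sub>2"
          by (auto simp: cone_def)
        then have "prefix_closed (W - ?X)" using W by (simp add: prefix_closed_Diff_cone)
        moreover obtain n where n: "card A = n + 2" "card (A - {p, r}) = n"
        proof -
          have "card {p, r} \<le> card A" using * p(1) psubset.hyps(1) by (intro card_mono) auto
          then have "card A = card A - 2 + 2" using *(2) by simp
          moreover have "card (A - {p, r}) = card A - 2"
            using *(1,2) p(1) by (subst card_Diff_subset) auto
          ultimately show thesis using that by blast
        qed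
        then have "4 * (p + r) + (card A)\<^sup>2 \<le> 4 * card ?X + (card (A - {p, r}))\<^sup>2"
          using *(6) by (simp add: power2_eq_square algebra_simps)
        ultimately show ?thesis using * p(1)
          by (intro extend[of "{p, r}" ?X "\<lambda>x. if x = p then c else c'"]) (use *(2) cone_subset in auto)
      qed
    qed
  qed
qed

section \<open>From a graph to a spanning list tree and back\<close>

lemma (in wf_digraph) exists_list_tree:
  assumes fin: "finite (verts G)" and root: "\<rho> \<in> verts G"
    and reach: "\<And>v. v \<in> verts G \<Longrightarrow> \<rho> \<rightarrow>\<^sup>*\<^bsub>G\<^esub> v"
  shows "\<exists>W. prefix_closed W \<and> finite W \<and> card W = card (verts G) \<and>
    (\<lambda>xs. last (\<rho> # xs)) ` W = verts G \<and> (\<forall>xs y. xs @ [y] \<in> W \<longrightarrow> last (\<rho> # xs) \<rightarrow>\<^bsub>G\<^esub> y)"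
proof -
  define e where "e xs = last (\<rho> # xs)" for xs
  define is_tree where "is_tree W \<longleftrightarrow> [] \<in> W \<and> prefix_closed W \<and> finite W \<and> inj_on e W \<and>
    e ` W \<subseteq> verts G \<and> (\<forall>xs y. xs @ [y] \<in> W \<longrightarrow> e xs \<rightarrow>\<^bsub>G\<^esub> y)" for W
  have "\<exists>W. is_tree W \<and> card W = Suc n" if "n < card (verts G)" for n
    using that
  proof (induction n)
    case 0
    have "is_tree {[]}" using root by (auto simp: is_tree_def prefix_closed_def e_def)
    then show ?case by (intro exI[of _ "{[]}"]) simp
  next
    case (Suc n)
    then obtain W where W: "is_tree W" "card W = Suc n" by auto
    then have card_e: "card (e ` W) = Suc n" by (simp add: is_tree_def card_image)
    \<comment> \<open>If no arc left the tree, it would contain everything reachable from the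
      root.\<close>
    have "\<exists>u\<in>e ` W. \<exists>y. u \<rightarrow>\<^bsub>G\<^esub> y \<and> y \<notin> e ` W"
    proof (rule ccontr)
      assume closed: "\<not> ?thesis"
      have "v \<in> e ` W" if "v \<in> verts G" for v
        using reach[OF that]
      proof (induction rule: reachable_induct)
        case base
        have "e [] \<in> e ` W" using W(1) unfolding is_tree_def by blast
        then show ?case by (simp add: e_def)
      next
        case (step x y)
        then show ?case using closed by blast
      qed
      then have "card (verts G) \<le> card (e ` W)"
        using W(1) by (intro card_mono) (auto simp: is_tree_def)
      then show False using Suc.prems card_e by simp
    qed
    then obtain xs y where xs: "xs \<in> W" "e xs \<rightarrow>\<^bsub>G\<^esub> y" "y \<notin> e ` W" by auto
    have e_snoc: "e (zs @ [z]) = z" for zs z by (simp add: e_def)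
    have new: "xs @ [y] \<notin> W" using xs(3) e_snoc[of xs y] by (metis imageI)
    have "is_tree (insert (xs @ [y]) W)"
      unfolding is_tree_def
    proof (intro conjI allI impI)
      show "[] \<in> insert (xs @ [y]) W" "finite (insert (xs @ [y]) W)"
        using W(1) by (auto simp: is_tree_def)
      show "prefix_closed (insert (xs @ [y]) W)"
        unfolding prefix_closed_def
      proof (intro ballI allI)
        fix u n assume "u \<in> insert (xs @ [y]) W"
        moreover have "take n (xs @ [y]) \<in> insert (xs @ [y]) W"
          using W(1) xs(1) by (cases "n \<le> length xs") (auto simp: is_tree_def prefix_closed_take)
        ultimately show "take n u \<in> insert (xs @ [y]) W"
          using W(1) by (auto simp: is_tree_def prefix_closed_take)
      qed
      show "inj_on e (insert (xs @ [y]) W)"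
        using W(1) xs(3) new by (auto simp: is_tree_def e_snoc)
      show "e ` insert (xs @ [y]) W \<subseteq> verts G"
        using W(1) adj_in_verts(2)[OF xs(2)] by (auto simp: is_tree_def e_snoc)
      show "e zs \<rightarrow>\<^bsub>G\<^esub> z" if "zs @ [z] \<in> insert (xs @ [y]) W" for zs z
        using that W(1) xs(2) by (auto simp: is_tree_def)
    qed
    moreover have "card (insert (xs @ [y]) W) = Suc (Suc n)"
      using W new by (simp add: is_tree_def)
    ultimately show ?case by blast
  qed
  from this[of "card (verts G) - 1"] have "\<exists>W. is_tree W \<and> card W = card (verts G)"
    using fin root by (cases "card (verts G)") auto
  then obtain W where W: "is_tree W" "card W = card (verts G)" by blast
  then have "card (e ` W) = card (verts G)" by (simp add: is_tree_def card_image)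
  then have "e ` W = verts G" using W(1) fin by (intro card_subset_eq) (auto simp: is_tree_def)
  with W show ?thesis unfolding is_tree_def e_def by blast
qed

text \<open>Walk from \<open>c\<close> up to the common ancestor and down to \<open>u\<close>. Tree
  arcs point away from the root, so the upward half uses symmetry.\<close>

lemma (in sym_digraph) mem_closed_nbhd_if_mem_tball:
  assumes W: "prefix_closed W" "\<And>xs y. xs @ [y] \<in> W \<Longrightarrow> last (\<rho> # xs) \<rightarrow>\<^bsub>G\<^esub> y"
    and c: "c \<in> W" "last (\<rho> # c) \<in> verts G" and u: "u \<in> W" "u \<in> tball c r"
  shows "last (\<rho> # u) \<in> closed_nbhd G r (last (\<rho> # c))"
proof -
  define e where "e xs = last (\<rho> # xs)" for xs
  have edge: "e (take n xs) \<rightarrow>\<^bsub>G\<^esub> e (take (Suc n) xs)" if "xs \<in> W" "n < length xs" for xs n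
    using W(2)[of "take n xs" "xs ! n"] prefix_closed_take[OF W(1) that(1), of "Suc n"] that(2)
    by (simp add: take_Suc_conv_app_nth e_def)
  have step: "w \<in> closed_nbhd G (Suc i) x" if "v \<in> closed_nbhd G i x" "v \<rightarrow>\<^bsub>G\<^esub> w" for v w i x
    using that by (auto simp: closed_nbhd_Suc neighbours_def)
  have up: "e (take (length c - i) c) \<in> closed_nbhd G i (e c)" if "i \<le> length c" for i
    using that
  proof (induction i)
    case 0
    then show ?case using c by (simp add: closed_nbhd_0 e_def)
  next
    case (Suc i)
    have "e (take (length c - Suc i) c) \<rightarrow>\<^bsub>G\<^esub> e (take (length c - i) c)"
      using edge[OF c(1), of "length c - Suc i"] Suc.prems by (simp add: Suc_diff_Suc)
    then have "e (take (length c - i) c) \<rightarrow>\<^bsub>G\<^esub> e (take (length c - Suc i) c)"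
      using sym_arcs by (auto simp: symmetric_def dest: symD)
    then show ?case using Suc by (auto intro: step)
  qed
  define m where "m = clen u c"
  have m: "m \<le> length u" "m \<le> length c" "take m u = take m c"
    using le_clen_iff[of m u c] by (auto simp: m_def)
  have down: "e (take (m + j) u) \<in> closed_nbhd G (length c - m + j) (e c)" if "m + j \<le> length u" for j
    using that
  proof (induction j)
    case 0
    then show ?case using up[of "length c - m"] m by simp
  next
    case (Suc j)
    then show ?case using edge[OF u(1), of "m + j"] by (auto intro: step)
  qed
  have "e u \<in> closed_nbhd G (length c - m + (length u - m)) (e c)"
    using down[of "length u - m"] m(1) by simp
  moreover have "length c - m + (length u - m) \<le> r" using u(2) m by (simp add: tball_def m_def)
  ultimately show ?thesis unfolding e_def closed_nbhd_iff by (auto intro: le_trans)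
qed

section \<open>The bound on the burning number\<close>

lemma (in graph) burning_number_le:
  assumes conn: "Digraph_Component.connected G" and k: "4 * card (verts G) + 2 * k \<le> 3 * k\<^sup>2"
  shows "burning_number G \<le> k"
proof -
  have sc: "strongly_connected G" using symmetric_connected_imp_strongly_connected[OF sym_arcs conn] .
  then obtain \<rho> where \<rho>: "\<rho> \<in> verts G" by (auto simp: strongly_connected_def)
  have "\<rho> \<rightarrow>\<^sup>*\<^bsub>G\<^esub> v" if "v \<in> verts G" for v using sc \<rho> that by (auto simp: strongly_connected_def)
  from exists_list_tree[OF finite_verts \<rho> this] obtain W where
    W: "prefix_closed W" "finite W" "card W = card (verts G)" "(\<lambda>xs. last (\<rho> # xs)) ` W = verts G"
      "\<And>xs y. xs @ [y] \<in> W \<Longrightarrow> last (\<rho> # xs) \<rightarrow>\<^bsub>G\<^esub> y" by auto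
  \<comment> \<open>For the radii \<open>{0..<k}\<close> the right-hand side in
    \<open>exists_ball_cover\<close> becomes \<open>3 * k\<^sup>2 - 2 * k\<close>.\<close>
  have "4 * \<Sum>{0..<k} + 2 * k = 2 * k\<^sup>2"
    by (induction k) (auto simp: power2_eq_square)
  then have "4 * card W \<le> 4 * \<Sum>{0..<k} + (card {0..<k})\<^sup>2"
    using k W(3) by simp
  from exists_ball_cover[OF W(1,2) finite_atLeastLessThan this]
  obtain c where c: "\<forall>r\<in>{0..<k}. c r \<in> insert [] W" "W \<subseteq> (\<Union>r\<in>{0..<k}. tball (c r) r)"
    by (elim exE conjE)
  have "[] \<in> W" using W(1,4) \<rho> prefix_closed_take[of W _ 0] by auto
  with c(1) have cW: "c r \<in> W" if "r < k" for r using that by force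
  have e_verts: "last (\<rho> # xs) \<in> verts G" if "xs \<in> W" for xs
    unfolding W(4)[symmetric] using that by (rule imageI)
  \<comment> \<open>A fire lit at step \<open>i\<close> reaches radius \<open>k - i\<close>, so step
    \<open>k - r\<close> uses the ball of radius \<open>r\<close>.\<close>
  define v where "v i = last (\<rho> # c (k - i))" for i
  have v: "\<forall>i\<in>{1..k}. v i \<in> verts G"
    unfolding v_def by (auto intro!: e_verts cW simp del: last.simps)
  have "verts G \<subseteq> (\<Union>i\<in>{1..k}. closed_nbhd G (k - i) (v i))"
  proof
    fix x assume "x \<in> verts G"
    then obtain u where u: "u \<in> W" "x = last (\<rho> # u)" using W(4) by blast
    then obtain r where r: "r < k" "u \<in> tball (c r) r" using c(2) by auto
    have "x \<in> closed_nbhd G r (last (\<rho> # c r))"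
      unfolding u(2) using W(1,5) cW[OF r(1)] e_verts[OF cW[OF r(1)]] u(1) r(2)
      by (rule mem_closed_nbhd_if_mem_tball)
    then have "x \<in> closed_nbhd G (k - (k - r)) (v (k - r))" using r(1) by (simp add: v_def)
    moreover have "k - r \<in> {1..k}" using r(1) by auto
    ultimately show "x \<in> (\<Union>i\<in>{1..k}. closed_nbhd G (k - i) (v i))" by blast
  qed
  moreover have "(\<Union>i\<in>{1..k}. closed_nbhd G (k - i) (v i)) \<subseteq> verts G"
    by (auto simp: closed_nbhd_def)
  ultimately have "on_fire G v k = verts G"
    unfolding on_fire_eq_covering[OF v] by (rule equalityI[rotated])
  with v show ?thesis unfolding burning_number_def by (intro Least_le exI conjI)
qed

theorem theorem1p7:
  fixes G :: "('a, 'b) pre_digraph"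
  assumes "graph G" and "Digraph_Component.connected G"
  shows "int (burning_number G) \<le> \<lceil>sqrt (4 * real (card (verts G)) / 3)\<rceil> + 1"
proof -
  define t where "t = nat \<lceil>sqrt (4 * real (card (verts G)) / 3)\<rceil>"
  have "-1 < sqrt (4 * real (card (verts G)) / 3)"
    by (rule less_le_trans[of _ 0]) simp_all
  then have t: "int t = \<lceil>sqrt (4 * real (card (verts G)) / 3)\<rceil>"
    unfolding t_def by simp
  then have "sqrt (4 * real (card (verts G)) / 3) \<le> real t" by linarith
  then have "4 * real (card (verts G)) / 3 \<le> (real t)\<^sup>2"
    using sqrt_le_D by blast
  then have "real (4 * card (verts G)) \<le> real (3 * t\<^sup>2)" by simp
  then have "4 * card (verts G) \<le> 3 * t\<^sup>2" by (simp only: of_nat_le_iff)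
  \<comment> \<open>Here the extra step is spent: going from \<open>t\<close> to
    \<open>t + 1\<close> adds \<open>6 * t + 3\<close> on the right, which absorbs the linear
    term.\<close>
  then have "4 * card (verts G) + 2 * (t + 1) \<le> 3 * (t + 1)\<^sup>2"
    by (simp add: power2_eq_square)
  then have "burning_number G \<le> t + 1"
    by (rule graph.burning_number_le[OF assms])
  then show ?thesis using t by linarith
qed

end
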